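(* Let $\mathcal S$ be an ISSIFS, $p\in(0,1]$, $\Lambda_{\mathcal S,p}$ the corresponding coin tossing integer self-similar set, and $\mathcal B=\{\mathbf B_0,\dots,\mathbf B_{L-1}\}$ the set of matrices associated with $\mathcal S$. If $p<(\check{\rho}(\mathcal B))^{-1}$, where $\check{\rho}(\mathcal B)$ denotes the lower spectral radius of $\mathcal B$, then $\Lambda_{\mathcal S,p}$ almost surely does not contain an interval.
   Context: Notation: $[k]=\{0,\dots,k-1\}$; $\mathbb N$ includes $0$ when used as a set of values. "Interval" means non-degenerate interval. ISSIFS: a finite list $\mathcal S=\{S_i(x)=\frac1Lx+t_i\}_{i=0}^{M-1}$ of maps of $\mathbb R$, with $L\ge2$ an integer, $t_i\in\mathbb N$, $0=t_0\le\cdots\le t_{M-1}$, and $L-1$ dividing $t_{M-1}$. Write $S_{i_1\dots i_n}=S_{i_1}\circ\cdots\circ S_{i_n}$. On $\Sigma_M=[M]^{\mathbb N}$ put $\Pi(\mathbf i)=\lim_{n\to\infty}S_{i_1\dots i_n}(0)$. Let $\eta=\Pi_*\mu$, where $\mu=(\frac1M,\dots,\frac1M)^{\mathbb N}$. The basic intervals are those intervals of the form $[(i-1)L,iL]$, $i\in\mathbb Z$, having positive $\eta$-measure; there are finitely many, say $N$, written $J^{(U)}=[b_UL,(b_U+1)L]$, $U\in[N]$, $b_U\in\mathbb N$, $b_0<b_1<\dots<b_{N-1}$. For $\theta\in[L]$ let $J^{(U)}_\theta=[b_UL+\theta,\,b_UL+\theta+1]$. The $N\times N$ matrix $\mathbf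 B_\theta$ is $\mathbf B_\theta(i,k)=\#\{\ell\in[M]:S_\ell(J^{(k)})=J^{(i)}_\theta\}$, $i,k\in[N]$. Random set: to each nonempty finite word $i_1\dots i_n$ over $[M]$ assign independent Bernoulli variables $X_{i_1\dots i_n}$ with $\mathbb P(X_{i_1\dots i_n}=1)=p$. Let $\mathcal E_\infty=\{\mathbf i\in\Sigma_M:X_{i_1\dots i_n}=1\ \forall n\ge1\}$. The coin tossing integer self-similar set is $\Lambda_{\mathcal S,p}=\Pi(\mathcal E_\infty)$. Lower spectral radius: for a submultiplicative matrix norm $\|\cdot\|_*$, $\check{\rho}_n(\mathcal B,\|\cdot\|_* )=\inf\{\|\mathbf B_{i_1}\cdots\mathbf B_{i_n}\|_*^{1/n}:\mathbf B_{i_j}\in\mathcal B,\ 1\le j\le n\}$ and $\check{\rho}(\mathcal B)=\lim_{n\to\infty}\check{\rho}_n(\mathcal B,\|\cdot\|_* )$ (the limit exists). *)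

theory Defs
  imports "HOL-Probability.Probability" "Jordan_Normal_Form.Matrix"
begin

text \<open>
  An ISSIFS is given by \<open>L\<close> and the list \<open>t = [t_0, ..., t_{M-1}]\<close> of translations;
  \<open>M\<close> is \<open>length t\<close>. Repeated translations are allowed and are counted with multiplicity.
\<close>

definition issifs :: "nat \<Rightarrow> nat list \<Rightarrow> bool" where
  "issifs L t \<longleftrightarrow> 2 \<le> L \<and> t \<noteq> [] \<and> t ! 0 = 0 \<and> sorted t \<and> (L - 1) dvd last t"

definition S :: "nat \<Rightarrow> nat list \<Rightarrow> nat \<Rightarrow> real \<Rightarrow> real" where
  "S L t i x = 1 / real L * x + real (t ! i)"

definition S_word :: "nat \<Rightarrow> nat list \<Rightarrow> nat list \<Rightarrow> real \<Rightarrow> real" where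
  "S_word L t w = foldr (\<lambda>i f. S L t i \<circ> f) w id"

text \<open>
  Infinite words are functions from \<^typ>\<open>nat\<close>, so the n-th letter has index \<open>n - 1\<close>.
\<close>

definition initial :: "nat \<Rightarrow> (nat \<Rightarrow> nat) \<Rightarrow> nat list" where
  "initial n \<sigma> = map \<sigma> [0..<n]"

definition Pi_proj :: "nat \<Rightarrow> nat list \<Rightarrow> (nat \<Rightarrow> nat) \<Rightarrow> real" where
  "Pi_proj L t \<sigma> = lim (\<lambda>n. S_word L t (initial n \<sigma>) 0)"

definition \<mu> :: "nat list \<Rightarrow> (nat \<Rightarrow> nat) measure" where
  "\<mu> t = (\<Pi>\<^sub>M n\<in>UNIV. uniform_count_measure {..<length t})"

definition \<eta> :: "nat \<Rightarrow> nat list \<Rightarrow> real measure" where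
  "\<eta> L t = distr (\<mu> t) borel (Pi_proj L t)"

text \<open>
  The left end points of the basic intervals, divided by \<open>L\<close>. They are natural numbers
  except when all translations vanish: then \<open>\<eta>\<close> is the Dirac measure at 0, and
  \<open>[-L, 0]\<close> has positive measure, too.
\<close>

definition basic_indices :: "nat \<Rightarrow> nat list \<Rightarrow> int set" where
  "basic_indices L t =
     {b. 0 < measure (\<eta> L t) {of_int b * real L .. (of_int b + 1) * real L}}"

definition num_basic :: "nat \<Rightarrow> nat list \<Rightarrow> nat" where
  "num_basic L t = card (basic_indices L t)"

definition basic_index :: "nat \<Rightarrow> nat list \<Rightarrow> nat \<Rightarrow> int" where
  "basic_index L t U = sorted_list_of_set (basic_indices L t) ! U"

definition J :: "nat \<Rightarrow> nat list \<Rightarrow> nat \<Rightarrow> real set" where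
  "J L t U = {of_int (basic_index L t U) * real L .. (of_int (basic_index L t U) + 1) * real L}"

definition J_sub :: "nat \<Rightarrow> nat list \<Rightarrow> nat \<Rightarrow> nat \<Rightarrow> real set" where
  "J_sub L t U \<theta> =
     {of_int (basic_index L t U) * real L + real \<theta> ..
      of_int (basic_index L t U) * real L + real \<theta> + 1}"

definition B_mat :: "nat \<Rightarrow> nat list \<Rightarrow> nat \<Rightarrow> real mat" where
  "B_mat L t \<theta> = Matrix.mat (num_basic L t) (num_basic L t)
     (\<lambda>(i, k). real (card {l \<in> {..<length t}. S L t l ` J L t k = J_sub L t i \<theta>}))"

definition B_set :: "nat \<Rightarrow> nat list \<Rightarrow> real mat set" where
  "B_set L t = B_mat L t ` {..<L}"

definition submult_matrix_norm :: "nat \<Rightarrow> (real mat \<Rightarrow> real) \<Rightarrow> bool" where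
  "submult_matrix_norm N nrm \<longleftrightarrow>
     (\<forall>A \<in> carrier_mat N N. 0 \<le> nrm A \<and> (nrm A = 0 \<longleftrightarrow> A = 0\<^sub>m N N)) \<and>
     (\<forall>c. \<forall>A \<in> carrier_mat N N. nrm (c \<cdot>\<^sub>m A) = \<bar>c\<bar> * nrm A) \<and>
     (\<forall>A \<in> carrier_mat N N. \<forall>B \<in> carrier_mat N N. nrm (A + B) \<le> nrm A + nrm B) \<and>
     (\<forall>A \<in> carrier_mat N N. \<forall>B \<in> carrier_mat N N. nrm (A * B) \<le> nrm A * nrm B)"

definition lower_spectral_radius_at ::
    "nat \<Rightarrow> (real mat \<Rightarrow> real) \<Rightarrow> real mat set \<Rightarrow> nat \<Rightarrow> real" where
  "lower_spectral_radius_at N nrm \<B> n =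
     (INF w \<in> {w. length w = n \<and> set w \<subseteq> \<B>}. root n (nrm (foldr (*) w (1\<^sub>m N))))"

text \<open>
  For sets of \<open>N\<close>-by-\<open>N\<close> matrices the value is the same for every submultiplicative norm.
  It can be 0, e.g. for \<open>L = 3\<close> and \<open>t = [0, 2]\<close>; its inverse is therefore taken in
  \<^typ>\<open>ereal\<close>, where the inverse of 0 is infinite.
\<close>

definition lower_spectral_radius ::
    "nat \<Rightarrow> (real mat \<Rightarrow> real) \<Rightarrow> real mat set \<Rightarrow> real" where
  "lower_spectral_radius N nrm \<B> = lim (lower_spectral_radius_at N nrm \<B>)"

definition finite_words :: "nat \<Rightarrow> nat list set" where
  "finite_words M = {w. w \<noteq> [] \<and> set w \<subseteq> {..<M}}"

definition coin_tosses ::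
    "'a measure \<Rightarrow> nat \<Rightarrow> real \<Rightarrow> (nat list \<Rightarrow> 'a \<Rightarrow> bool) \<Rightarrow> bool" where
  "coin_tosses P M p X \<longleftrightarrow>
     prob_space P \<and>
     prob_space.indep_vars P (\<lambda>_. count_space UNIV) X (finite_words M) \<and>
     (\<forall>w \<in> finite_words M. measure P {\<omega> \<in> space P. X w \<omega>} = p)"

definition E_infinity :: "nat \<Rightarrow> (nat list \<Rightarrow> 'a \<Rightarrow> bool) \<Rightarrow> 'a \<Rightarrow> (nat \<Rightarrow> nat) set" where
  "E_infinity M X \<omega> =
     {\<sigma> \<in> UNIV \<rightarrow> {..<M}. \<forall>n\<ge>1. X (initial n \<sigma>) \<omega>}"

definition coin_tossing_set ::
    "nat \<Rightarrow> nat list \<Rightarrow> (nat list \<Rightarrow> 'a \<Rightarrow> bool) \<Rightarrow> 'a \<Rightarrow> real set" where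
  "coin_tossing_set L t X \<omega> = Pi_proj L t ` E_infinity (length t) X \<omega>"

definition contains_interval :: "real set \<Rightarrow> bool" where
  "contains_interval A \<longleftrightarrow> (\<exists>I. is_interval I \<and> (\<exists>x\<in>I. \<exists>y\<in>I. x \<noteq> y) \<and> I \<subseteq> A)"

end

theory Submission
  imports Defs
begin

text \<open>
  The proof is a first moment argument along one periodic sequence of digits.

  By submultiplicativity, the limit that defines the lower spectral radius exists and is an
  infimum (\<open>lower_spectral_radius_at_tendsto\<close>). So the hypothesis on \<open>p\<close> yields digits
  \<open>\<theta>\<^sub>1, ..., \<theta>\<^sub>n\<close> for which \<open>p ^ n\<close> times the norm of \<open>Q\<close>, the product of the matrices of these
  digits, is less than 1 (\<open>contracting_product_exists\<close>). The \<open>(i, k)\<close> entry of a product of matrices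
  bounds the number of words \<open>w\<close> that map the \<open>k\<close>-th basic interval onto the L-adic subinterval of the
  \<open>i\<close>-th basic interval with the given digits (\<open>card_words_le_matprod\<close>). A word of length \<open>n\<close> survives
  with probability \<open>p ^ n\<close>.

  Call the intervals from \<open>j * L / L ^ m\<close> to \<open>(j + 1) * L / L ^ m\<close> the cells of level \<open>m\<close>. If
  a cell is contained in the random set, then the code of its midpoint shows that some
  surviving word of length \<open>m\<close> maps a basic interval onto the cell
  (\<open>alive_covering_word_of_cell_subset\<close>). Inside a fixed cell of level \<open>m\<close>, consider the cell obtained by
  appending the block of digits \<open>k\<close> times. The expected number of surviving words for it is
  at most a constant times the sum of the entries of \<open>p ^ (k * n)\<close> times the \<open>k\<close>-th power of \<open>Q\<close>,
  and this tends to 0 as \<open>k\<close> grows. Hence the fixed cell is almost surely not contained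
  in the random set (\<open>AE_not_cell_subset\<close>). Every non-degenerate interval contains a cell, and there
  are only countably many cells.
\<close>

section \<open>Matrix products and the lower spectral radius\<close>

lemma mult_mat_entry:
  assumes "A \<in> carrier_mat N N" "B \<in> carrier_mat N N" "i < N" "j < N"
  shows "(A * B) $$ (i, j) = (\<Sum>k<N. A $$ (i, k) * B $$ (k, j))"
  using assms by (auto simp: scalar_prod_def atLeast0LessThan intro!: sum.cong)

lemma matprod_carrier:
  fixes w :: "'b :: semiring_1 mat list"
  assumes "set w \<subseteq> carrier_mat N N"
  shows "foldr (*) w (1\<^sub>m N) \<in> carrier_mat N N"
  using assms by (induction w) auto

lemma matprod_append:
  fixes u v :: "'b :: semiring_1 mat list"
  assumes "set u \<subseteq> carrier_mat N N" "set v \<subseteq> carrier_mat N N"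
  shows "foldr (*) (u @ v) (1\<^sub>m N) = foldr (*) u (1\<^sub>m N) * foldr (*) v (1\<^sub>m N)"
  using assms(1)
proof (induction u)
  case Nil
  then show ?case using left_mult_one_mat[OF matprod_carrier[OF assms(2)]] by simp
next
  case (Cons A u)
  then show ?case
    using matprod_carrier[of u N] matprod_carrier[OF assms(2)]
    by (simp add: assoc_mult_mat[of A N N _ N _ N])
qed

lemma norm_matprod_nonneg:
  assumes "submult_matrix_norm N nrm" "\<B> \<subseteq> carrier_mat N N" "set w \<subseteq> \<B>"
  shows "0 \<le> nrm (foldr (*) w (1\<^sub>m N))"
  using assms matprod_carrier[of w N] unfolding submult_matrix_norm_def by blast

text \<open>
  Repeating a block \<open>w\<close> serves twice: with a tail \<open>u\<close> for the subadditivity argument behind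
  the lower spectral radius, and with empty \<open>u\<close> for the powers of one contracting product.
\<close>

lemma norm_matprod_repeat:
  assumes nrm: "submult_matrix_norm N nrm"
    and w: "set w \<subseteq> carrier_mat N N" and u: "set u \<subseteq> carrier_mat N N"
  shows "nrm (foldr (*) (concat (replicate q w) @ u) (1\<^sub>m N))
         \<le> nrm (foldr (*) w (1\<^sub>m N)) ^ q * nrm (foldr (*) u (1\<^sub>m N))"
proof (induction q)
  case 0
  then show ?case by simp
next
  case (Suc q)
  let ?v = "concat (replicate q w) @ u"
  have v: "set ?v \<subseteq> carrier_mat N N"
    using w u by (auto split: if_splits)
  have "nrm (foldr (*) (w @ ?v) (1\<^sub>m N))
        \<le> nrm (foldr (*) w (1\<^sub>m N)) * nrm (foldr (*) ?v (1\<^sub>m N))"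
    unfolding matprod_append[OF w v]
    using nrm matprod_carrier[OF w] matprod_carrier[OF v] by (auto simp: submult_matrix_norm_def)
  also have "\<dots> \<le> nrm (foldr (*) w (1\<^sub>m N)) *
      (nrm (foldr (*) w (1\<^sub>m N)) ^ q * nrm (foldr (*) u (1\<^sub>m N)))"
    using nrm matprod_carrier[OF w] Suc.IH
    by (intro mult_left_mono) (auto simp: submult_matrix_norm_def)
  finally show ?case by (simp add: mult.assoc)
qed

text \<open>
  For an arbitrary norm this is the equivalence of norms in finite dimension, but
  submultiplicativity gives a direct proof: with the matrix units \<open>E\<close>, the product
  \<open>E i i * A * E j j\<close> equals \<open>E i j\<close> scaled by the entry of \<open>A\<close> at \<open>(i, j)\<close>.
\<close>

lemma entry_bounded_by_norm:
  assumes nrm: "submult_matrix_norm N nrm" and i: "i < N" and j: "j < N"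
  shows "\<exists>C. \<forall>A \<in> carrier_mat N N. \<bar>A $$ (i, j)\<bar> \<le> C * nrm A"
proof -
  define E where "E a b = mat N N (\<lambda>(x, y). if x = a \<and> y = b then 1 else 0 :: real)" for a b
  have Ec: "E a b \<in> carrier_mat N N" for a b by (simp add: E_def)
  have Ee: "E x y $$ (a, b) = (if a = x \<and> b = y then 1 else 0)" if "a < N" "b < N" for x y a b
    using that by (simp add: E_def)
  have "nrm (E i j) \<noteq> 0"
  proof
    assume "nrm (E i j) = 0"
    then have "E i j = 0\<^sub>m N N" using nrm Ec by (auto simp: submult_matrix_norm_def)
    then have "E i j $$ (i, j) = 0" using i j by simp
    then show False using i j by (simp add: E_def)
  qed
  moreover have "0 \<le> nrm (E i j)" using nrm Ec by (auto simp: submult_matrix_norm_def)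
  ultimately have pos: "0 < nrm (E i j)" by simp
  have "\<bar>A $$ (i, j)\<bar> \<le> (nrm (E i i) * nrm (E j j) / nrm (E i j)) * nrm A"
    if A: "A \<in> carrier_mat N N" for A
  proof -
    have 1: "(E i i * A) $$ (a, b) = (if a = i then A $$ (i, b) else 0)"
      if "a < N" "b < N" for a b
    proof -
      have "(E i i * A) $$ (a, b) = (\<Sum>k<N. (if k = i \<and> a = i then A $$ (k, b) else 0))"
        unfolding mult_mat_entry[OF Ec A that] using that by (intro sum.cong) (auto simp: E_def)
      also have "\<dots> = (if a = i then A $$ (i, b) else 0)"
        using i by (cases "a = i") (auto simp: sum.delta)
      finally show ?thesis .
    qed
    have EA: "E i i * A \<in> carrier_mat N N" using mult_carrier_mat[OF Ec A] .
    have "(E i i * A) * E j j = A $$ (i, j) \<cdot>\<^sub>m E i j"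
    proof (rule eq_matI)
      fix a b assume "a < dim_row (A $$ (i, j) \<cdot>\<^sub>m E i j)" "b < dim_col (A $$ (i, j) \<cdot>\<^sub>m E i j)"
      then have ab: "a < N" "b < N" by (auto simp: E_def)
      have "((E i i * A) * E j j) $$ (a, b) = (\<Sum>k<N. (E i i * A) $$ (a, k) * E j j $$ (k, b))"
        by (rule mult_mat_entry[OF EA Ec ab])
      also have "\<dots> = (\<Sum>k<N. (if k = j \<and> b = j \<and> a = i then A $$ (i, k) else 0))"
        using ab j by (intro sum.cong) (auto simp: 1 Ee)
      also have "\<dots> = (if b = j \<and> a = i then A $$ (i, j) else 0)"
        using j by (cases "b = j \<and> a = i") (auto simp: sum.delta)
      also have "\<dots> = (A $$ (i, j) \<cdot>\<^sub>m E i j) $$ (a, b)" using ab by (auto simp: E_def)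
      finally show "((E i i * A) * E j j) $$ (a, b) = (A $$ (i, j) \<cdot>\<^sub>m E i j) $$ (a, b)" .
    qed (use Ec A in \<open>auto simp: E_def\<close>)
    then have "\<bar>A $$ (i, j)\<bar> * nrm (E i j) = nrm ((E i i * A) * E j j)"
      using nrm Ec by (simp add: submult_matrix_norm_def)
    also have "\<dots> \<le> nrm (E i i * A) * nrm (E j j)"
      using nrm Ec EA by (auto simp: submult_matrix_norm_def)
    also have "\<dots> \<le> nrm (E i i) * nrm A * nrm (E j j)"
      using nrm Ec A by (intro mult_right_mono) (auto simp: submult_matrix_norm_def)
    finally show ?thesis using pos by (simp add: field_simps)
  qed
  then show ?thesis by blast
qed

lemma lower_spectral_radius_at_le:
  assumes nrm: "submult_matrix_norm N nrm" and \<B>: "\<B> \<subseteq> carrier_mat N N"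
    and w: "set w \<subseteq> \<B>"
  shows "lower_spectral_radius_at N nrm \<B> (length w) \<le> root (length w) (nrm (foldr (*) w (1\<^sub>m N)))"
  unfolding lower_spectral_radius_at_def
proof (rule cINF_lower)
  show "bdd_below ((\<lambda>wa. root (length w) (nrm (foldr (*) wa (1\<^sub>m N)))) `
      {wa. length wa = length w \<and> set wa \<subseteq> \<B>})"
    using norm_matprod_nonneg[OF nrm \<B>]
    by (intro bdd_belowI[of _ 0]) (auto intro!: real_root_ge_zero)
qed (use w in auto)

lemma lower_spectral_radius_at_nonneg:
  assumes nrm: "submult_matrix_norm N nrm" and \<B>: "\<B> \<subseteq> carrier_mat N N" "\<B> \<noteq> {}"
  shows "0 \<le> lower_spectral_radius_at N nrm \<B> n"
proof -
  obtain A where "A \<in> \<B>" using \<B> by blast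
  then have "replicate n A \<in> {w. length w = n \<and> set w \<subseteq> \<B>}" by auto
  then show ?thesis
    unfolding lower_spectral_radius_at_def using norm_matprod_nonneg[OF nrm \<B>(1)]
    by (intro cINF_greatest) (blast, auto intro!: real_root_ge_zero)
qed

lemma short_product_of_lower_spectral_radius_at_less:
  assumes nrm: "submult_matrix_norm N nrm" and \<B>: "\<B> \<subseteq> carrier_mat N N" "\<B> \<noteq> {}"
    and less: "lower_spectral_radius_at N nrm \<B> n < d" and n: "0 < n"
  obtains w where "length w = n" "set w \<subseteq> \<B>" "nrm (foldr (*) w (1\<^sub>m N)) < d ^ n"
proof -
  obtain A where "A \<in> \<B>" using \<B> by blast
  then have "replicate n A \<in> {w. length w = n \<and> set w \<subseteq> \<B>}" by auto
  then have ne: "(\<lambda>w. root n (nrm (foldr (*) w (1\<^sub>m N)))) ` {w. length w = n \<and> set w \<subseteq> \<B>} \<noteq> {}"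
    by blast
  obtain w where w: "length w = n" "set w \<subseteq> \<B>" "root n (nrm (foldr (*) w (1\<^sub>m N))) < d"
    using cInf_lessD[OF ne less[unfolded lower_spectral_radius_at_def]] by auto
  have pos: "0 \<le> nrm (foldr (*) w (1\<^sub>m N))"
    using norm_matprod_nonneg[OF nrm \<B>(1) w(2)] .
  have "nrm (foldr (*) w (1\<^sub>m N)) = root n (nrm (foldr (*) w (1\<^sub>m N))) ^ n"
    using n pos by (simp add: real_root_pow_pos2)
  also have "\<dots> < d ^ n"
    using w(3) n pos by (intro power_strict_mono) auto
  finally show ?thesis using that w by blast
qed

text \<open>
  Fekete's argument. If some block \<open>w\<close> of length \<open>n\<close> has a product of norm below \<open>d ^ n\<close>, then
  repeating \<open>w\<close> and filling up with fewer than \<open>n\<close> further factors gives words of every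
  length \<open>m\<close> whose product has norm at most \<open>d ^ m\<close> up to a constant, and the
  \<open>m\<close>-th root of a constant tends to 1. Working with a bound \<open>d\<close> strictly above the infimum
  keeps \<open>d\<close> positive even when the infimum is 0.
\<close>

lemma lower_spectral_radius_at_tendsto:
  assumes nrm: "submult_matrix_norm N nrm" and \<B>: "\<B> \<subseteq> carrier_mat N N" "\<B> \<noteq> {}"
  shows "lower_spectral_radius_at N nrm \<B>
           \<longlonglongrightarrow> (INF n\<in>{0<..}. lower_spectral_radius_at N nrm \<B> n)"
    (is "?f \<longlonglongrightarrow> ?c")
proof -
  have bdd: "bdd_below (?f ` {0<..})"
    using lower_spectral_radius_at_nonneg[OF nrm \<B>] by (intro bdd_belowI[of _ 0]) auto
  have c0: "0 \<le> ?c"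
    using lower_spectral_radius_at_nonneg[OF nrm \<B>] by (intro cINF_greatest) auto
  have above: "\<forall>\<^sub>F m in sequentially. ?f m < e" if e: "?c < e" for e
  proof -
    obtain d where d: "?c < d" "d < e" using dense[OF e] by blast
    have d0: "0 < d" using c0 d by simp
    have "?f ` {0<..} \<noteq> {}" by blast
    then obtain n where n: "0 < n" "?f n < d" using cInf_lessD[of "?f ` {0<..}" d] d by auto
    obtain w where w: "length w = n" "set w \<subseteq> \<B>" "nrm (foldr (*) w (1\<^sub>m N)) < d ^ n"
      using short_product_of_lower_spectral_radius_at_less[OF nrm \<B> n(2,1)] by blast
    obtain A where A: "A \<in> \<B>" using \<B> by blast
    \<comment> \<open>The constant that absorbs the incomplete block at the end; the added 1 keeps it positive.\<close>
    define K where "K = (\<Sum>r<n. nrm (foldr (*) (replicate r A) (1\<^sub>m N)) / d ^ r) + 1"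
    have Kr0: "0 \<le> nrm (foldr (*) (replicate r A) (1\<^sub>m N))" for r
      by (rule norm_matprod_nonneg[OF nrm \<B>(1)]) (use A in auto)
    have K0: "0 < K" unfolding K_def using Kr0 d0
      by (intro add_nonneg_pos sum_nonneg) auto
    have bound: "?f m \<le> d * root m K" if m: "0 < m" for m
    proof -
      define q r where "q = m div n" and "r = m mod n"
      have mqr: "m = q * n + r" and r: "r < n" using n by (auto simp: q_def r_def)
      let ?v = "concat (replicate q w) @ replicate r A"
      have len: "length ?v = m"
        using w(1) by (simp add: length_concat sum_list_replicate mqr)
      have v: "set ?v \<subseteq> \<B>" using w A by (auto split: if_splits)
      have w0: "0 \<le> nrm (foldr (*) w (1\<^sub>m N))"
        using norm_matprod_nonneg[OF nrm \<B>(1) w(2)] .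
      have "nrm (foldr (*) ?v (1\<^sub>m N))
          \<le> nrm (foldr (*) w (1\<^sub>m N)) ^ q * nrm (foldr (*) (replicate r A) (1\<^sub>m N))"
        using order_trans[OF w(2) \<B>(1)] A \<B>(1)
        by (intro norm_matprod_repeat[OF nrm]) (auto simp: set_replicate_conv_if)
      also have "\<dots> \<le> (d ^ n) ^ q * (d ^ r * K)"
      proof (rule mult_mono)
        let ?a = "\<lambda>r. nrm (foldr (*) (replicate r A) (1\<^sub>m N)) / d ^ r"
        have "?a r \<le> sum ?a {..<n}"
          by (rule member_le_sum) (use r Kr0 d0 in \<open>auto simp del: foldr_replicate\<close>)
        then have "?a r \<le> K" unfolding K_def by linarith
        then show "nrm (foldr (*) (replicate r A) (1\<^sub>m N)) \<le> d ^ r * K"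
          using d0 by (simp add: field_simps)
        show "nrm (foldr (*) w (1\<^sub>m N)) ^ q \<le> (d ^ n) ^ q"
          using w w0 by (intro power_mono) auto
      qed (use d0 Kr0 in auto)
      also have "\<dots> = d ^ m * K"
        by (simp add: mqr power_add power_mult mult.commute[of q n])
      finally have "nrm (foldr (*) ?v (1\<^sub>m N)) \<le> d ^ m * K" .
      then have "root m (nrm (foldr (*) ?v (1\<^sub>m N))) \<le> root m (d ^ m * K)"
        using m by simp
      also have "\<dots> = d * root m K"
        using m d0 by (simp add: real_root_mult real_root_power_cancel)
      finally have "root m (nrm (foldr (*) ?v (1\<^sub>m N))) \<le> d * root m K" .
      then show ?thesis
        using lower_spectral_radius_at_le[OF nrm \<B>(1) v] unfolding len by linarith
    qed
    have "(\<lambda>m. d * root m K) \<longlonglongrightarrow> d * 1"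
      by (intro tendsto_intros LIMSEQ_root_const K0)
    then have "\<forall>\<^sub>F m in sequentially. d * root m K < e"
      using d by (intro order_tendstoD) auto
    then show ?thesis
      using eventually_gt_at_top[of 0]
    proof eventually_elim
      case (elim m)
      then show ?case using bound[of m] by linarith
    qed
  qed
  show ?thesis
  proof (rule order_tendstoI)
    fix a assume a: "a < ?c"
    show "\<forall>\<^sub>F m in sequentially. a < ?f m"
      using eventually_gt_at_top[of 0]
    proof eventually_elim
      case (elim m)
      then have "?c \<le> ?f m" using bdd by (intro cINF_lower) auto
      then show ?case using a by simp
    qed
  qed (use above in blast)
qed

lemma contracting_product_exists:
  assumes nrm: "submult_matrix_norm N nrm" and \<B>: "\<B> \<subseteq> carrier_mat N N" "\<B> \<noteq> {}"
    and p: "0 < p" "ereal p < inverse (ereal (lower_spectral_radius N nrm \<B>))"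
  obtains w where "w \<noteq> []" "set w \<subseteq> \<B>" "p ^ length w * nrm (foldr (*) w (1\<^sub>m N)) < 1"
proof -
  let ?f = "lower_spectral_radius_at N nrm \<B>"
  define c where "c = (INF n\<in>{0<..}. ?f n)"
  have c: "lower_spectral_radius N nrm \<B> = c"
    unfolding lower_spectral_radius_def c_def
    by (rule limI[OF lower_spectral_radius_at_tendsto[OF nrm \<B>]])
  have c0: "0 \<le> c" unfolding c_def
    using lower_spectral_radius_at_nonneg[OF nrm \<B>] by (intro cINF_greatest) auto
  have "c < 1 / p"
  proof (cases "c = 0")
    case False
    then have "p < 1 / c" using p c c0 by (simp add: inverse_eq_divide)
    then show ?thesis using c0 False p by (simp add: field_simps)
  qed (use p in simp)
  moreover have "?f ` {0<..} \<noteq> {}" by blast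
  ultimately obtain n where n: "0 < n" "?f n < 1 / p"
    unfolding c_def using cInf_lessD[of "?f ` {0<..}" "1 / p"] by auto
  obtain w where w: "length w = n" "set w \<subseteq> \<B>" "nrm (foldr (*) w (1\<^sub>m N)) < (1 / p) ^ n"
    using short_product_of_lower_spectral_radius_at_less[OF nrm \<B> n(2,1)] by blast
  have "p ^ length w * nrm (foldr (*) w (1\<^sub>m N)) < 1"
    using w p by (simp add: field_simps)
  with w n show ?thesis by (intro that[of w]) auto
qed


section \<open>Coding by words and integer offsets\<close>

text \<open>
  Most significant digit first. The digits may exceed \<open>L - 1\<close>, as the translations can.
\<close>

primrec radix_value :: "nat \<Rightarrow> nat list \<Rightarrow> nat" where
  "radix_value L [] = 0"
| "radix_value L (d # ds) = d * L ^ length ds + radix_value L ds"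

lemma radix_value_append:
  "radix_value L (ds @ es) = radix_value L ds * L ^ length es + radix_value L es"
  by (induction ds) (auto simp: algebra_simps power_add)

lemma radix_value_less:
  assumes "0 < L" "set ds \<subseteq> {..<L}"
  shows "radix_value L ds < L ^ length ds"
  using assms(2)
proof (induction ds)
  case (Cons d ds)
  have "d * L ^ length ds + L ^ length ds \<le> L * L ^ length ds"
    using Cons.prems mult_le_mono1[of "Suc d" L "L ^ length ds"] by auto
  then show ?case using Cons by simp
qed simp

text \<open>
  The composition \<open>S_word L t w\<close> maps \<open>x\<close> to \<open>(x + L * offset L t w) / L ^ length w\<close>. Hence the image of
  the interval from \<open>b * L\<close> to \<open>(b + 1) * L\<close> is determined by the integer \<open>offset L t w + b\<close> and
  the length of \<open>w\<close>, and questions about images of basic intervals become equations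
  between integers.
\<close>

definition offset :: "nat \<Rightarrow> nat list \<Rightarrow> nat list \<Rightarrow> nat" where
  "offset L t w = radix_value L (map ((!) t) w)"

lemma offset_simps [simp]:
  "offset L t [] = 0"
  "offset L t (l # w) = (t ! l) * L ^ length w + offset L t w"
  by (simp_all add: offset_def)

lemma offset_append:
  "offset L t (u @ v) = offset L t u * L ^ length v + offset L t v"
  by (simp add: offset_def radix_value_append)

lemma S_word_Nil [simp]: "S_word L t [] x = x"
  and S_word_Cons [simp]: "S_word L t (l # w) x = S L t l (S_word L t w x)"
  by (simp_all add: S_word_def)

lemma S_word_append: "S_word L t (u @ v) x = S_word L t u (S_word L t v x)"
  by (induction u) auto

lemma S_word_eq_offset:
  assumes "0 < L"
  shows "S_word L t w x = (x + real L * real (offset L t w)) / real L ^ length w"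
  using assms by (induction w) (auto simp: S_def field_simps)

lemma length_initial [simp]: "length (initial n \<sigma>) = n"
  by (simp add: initial_def)

lemma set_initial: "\<sigma> \<in> UNIV \<rightarrow> {..<M} \<Longrightarrow> set (initial n \<sigma>) \<subseteq> {..<M}"
  by (auto simp: initial_def)

lemma take_initial: "k \<le> n \<Longrightarrow> take k (initial n \<sigma>) = initial k \<sigma>"
  by (simp add: initial_def take_map)

lemma initial_add: "initial (m + n) \<sigma> = initial m \<sigma> @ initial n (\<lambda>i. \<sigma> (m + i))"
  by (rule nth_equalityI) (auto simp: initial_def nth_append)

lemma S_word_initial_0:
  assumes "0 < L"
  shows "S_word L t (initial n \<sigma>) 0 = (\<Sum>k<n. real (t ! \<sigma> k) / real L ^ k)"
proof (induction n)
  case 0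
  then show ?case by (simp add: initial_def)
next
  case (Suc n)
  have 1: "initial (Suc n) \<sigma> = initial n \<sigma> @ [\<sigma> n]" by (simp add: initial_def)
  have "S_word L t (initial (Suc n) \<sigma>) 0 = S_word L t (initial n \<sigma>) 0 + real (t ! \<sigma> n) / real L ^ n"
    unfolding 1 S_word_append S_word_eq_offset[OF assms, of _ "initial n \<sigma>"]
    by (simp add: S_def add_divide_distrib)
  then show ?case using Suc by simp
qed

section \<open>The self-similar measure and the basic intervals\<close>

text \<open>
  A crude upper bound for the attractor: all that matters is that the projections of all
  codes lie in one bounded interval.
\<close>

definition Pi_bound :: "nat \<Rightarrow> nat list \<Rightarrow> real" where
  "Pi_bound L t = (\<Sum>k. real (sum_list t) / real L ^ k)"

context
  fixes L :: nat and t :: "nat list"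
  assumes issifs: "issifs L t"
begin

lemma L_ge_2: "2 \<le> L" and t_nonempty: "t \<noteq> []"
  using issifs by (auto simp: issifs_def)

lemma L_pos: "0 < L"
  using L_ge_2 by simp

lemma summable_Pi_bound: "summable (\<lambda>k. real (sum_list t) / real L ^ k)"
proof -
  have "summable (\<lambda>k. real (sum_list t) * (1 / real L) ^ k)"
    using L_ge_2 by (intro summable_mult summable_geometric) auto
  then show ?thesis by (simp add: power_divide)
qed

lemma Pi_proj_series:
  assumes \<sigma>: "\<sigma> \<in> UNIV \<rightarrow> {..<length t}"
  shows "(\<lambda>k. real (t ! \<sigma> k) / real L ^ k) sums Pi_proj L t \<sigma>"
    and "Pi_proj L t \<sigma> \<in> {0..Pi_bound L t}"
proof -
  have le: "real (t ! \<sigma> k) / real L ^ k \<le> real (sum_list t) / real L ^ k" for k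
    using elem_le_sum_list[of "\<sigma> k" t] \<sigma> L_pos by (intro divide_right_mono) auto
  have s: "summable (\<lambda>k. real (t ! \<sigma> k) / real L ^ k)"
    by (rule summable_comparison_test[OF _ summable_Pi_bound]) (use le in auto)
  then have *: "(\<lambda>n. S_word L t (initial n \<sigma>) 0) \<longlonglongrightarrow> (\<Sum>k. real (t ! \<sigma> k) / real L ^ k)"
    unfolding S_word_initial_0[OF L_pos] by (rule summable_LIMSEQ)
  then have eq: "Pi_proj L t \<sigma> = (\<Sum>k. real (t ! \<sigma> k) / real L ^ k)"
    unfolding Pi_proj_def by (rule limI)
  show "(\<lambda>k. real (t ! \<sigma> k) / real L ^ k) sums Pi_proj L t \<sigma>"
    unfolding eq using s by (rule summable_sums)
  show "Pi_proj L t \<sigma> \<in> {0..Pi_bound L t}"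
    unfolding eq Pi_bound_def using s summable_Pi_bound le
    by (auto intro: suminf_nonneg suminf_le)
qed

lemma Pi_proj_self_similar:
  assumes \<sigma>: "\<sigma> \<in> UNIV \<rightarrow> {..<length t}"
  shows "Pi_proj L t \<sigma> = S_word L t (initial m \<sigma>) (Pi_proj L t (\<lambda>i. \<sigma> (m + i)))"
proof -
  have lim: "(\<lambda>n. S_word L t (initial n \<tau>) 0) \<longlonglongrightarrow> Pi_proj L t \<tau>" if "\<tau> \<in> UNIV \<rightarrow> {..<length t}" for \<tau>
    using Pi_proj_series(1)[OF that] unfolding sums_def S_word_initial_0[OF L_pos] .
  have "(\<lambda>n. S_word L t (initial (m + n) \<sigma>) 0) \<longlonglongrightarrow>
      S_word L t (initial m \<sigma>) (Pi_proj L t (\<lambda>i. \<sigma> (m + i)))"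
    unfolding initial_add S_word_append S_word_eq_offset[OF L_pos, of t "initial m \<sigma>"]
    by (intro tendsto_intros lim) (use \<sigma> L_pos in auto)
  moreover have "(\<lambda>n. S_word L t (initial (m + n) \<sigma>) 0) \<longlonglongrightarrow> Pi_proj L t \<sigma>"
    using LIMSEQ_ignore_initial_segment[OF lim[OF \<sigma>], of m] by (simp add: add.commute)
  ultimately show ?thesis using LIMSEQ_unique by blast
qed

lemma Pi_proj_Cons:
  assumes "l < length t" "\<sigma> \<in> UNIV \<rightarrow> {..<length t}"
  shows "Pi_proj L t (case_nat l \<sigma>) = S L t l (Pi_proj L t \<sigma>)"
proof -
  have "case_nat l \<sigma> \<in> UNIV \<rightarrow> {..<length t}"
    using assms by (auto simp: Pi_iff split: nat.splits)
  from Pi_proj_self_similar[OF this, of 1] show ?thesis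
    by (simp add: initial_def)
qed

lemma sequence_space_letters: "sequence_space (uniform_count_measure {..<length t})"
proof -
  interpret prob_space "uniform_count_measure {..<length t}"
    using t_nonempty by (intro prob_space_uniform_count_measure) auto
  show ?thesis by unfold_locales
qed

lemma prob_space_\<mu>: "prob_space (\<mu> t)"
proof -
  interpret sequence_space "uniform_count_measure {..<length t}" by (rule sequence_space_letters)
  show ?thesis unfolding \<mu>_def by (rule prob_space_axioms)
qed

lemma space_\<mu>: "space (\<mu> t) = UNIV \<rightarrow> {..<length t}"
  by (auto simp: \<mu>_def space_PiM space_uniform_count_measure PiE_def)

lemma measurable_Pi_proj: "Pi_proj L t \<in> borel_measurable (\<mu> t)"
proof -
  have "(\<lambda>\<sigma>. real (t ! \<sigma> k)) \<in> borel_measurable (\<mu> t)" for k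
  proof (rule measurable_compose[where g = "\<lambda>l. real (t ! l)"])
    show "(\<lambda>\<sigma>. \<sigma> k) \<in> measurable (\<mu> t) (uniform_count_measure {..<length t})"
      unfolding \<mu>_def by (rule measurable_component_singleton) simp
    show "(\<lambda>l. real (t ! l)) \<in> borel_measurable (uniform_count_measure {..<length t})"
      by (simp add: measurable_cong_sets[OF sets_uniform_count_measure_count_space refl])
  qed
  then have "(\<lambda>\<sigma>. lim (\<lambda>n. \<Sum>k<n. real (t ! \<sigma> k) / real L ^ k)) \<in> borel_measurable (\<mu> t)"
    by (intro borel_measurable_lim_metric borel_measurable_sum borel_measurable_divide) auto
  then show ?thesis
    unfolding Pi_proj_def[abs_def] S_word_initial_0[OF L_pos] .
qed

lemma prob_space_\<eta>: "prob_space (\<eta> L t)"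
  unfolding \<eta>_def by (rule prob_space.prob_space_distr[OF prob_space_\<mu> measurable_Pi_proj])

lemma measure_\<eta>:
  assumes "A \<in> sets borel"
  shows "measure (\<eta> L t) A = measure (\<mu> t) {\<sigma> \<in> space (\<mu> t). Pi_proj L t \<sigma> \<in> A}"
  unfolding \<eta>_def measure_distr[OF measurable_Pi_proj assms]
  by (rule arg_cong[where f = "measure (\<mu> t)"]) auto

text \<open>
  Prefixing a random code with an independent uniform letter does not change its
  distribution, and the prefixed letter is \<open>l\<close> with probability \<open>1 / length t\<close>. The
  inequality is one term of the self-similarity relation for \<open>\<eta> L t\<close>.
\<close>

lemma \<eta>_preimage_le:
  assumes l: "l < length t" and A: "A \<in> sets borel"
  shows "measure (\<eta> L t) (S L t l -` A) \<le> real (length t) * measure (\<eta> L t) A"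
proof -
  let ?U = "uniform_count_measure {..<length t}"
  interpret \<mu>: prob_space "\<mu> t" by (rule prob_space_\<mu>)
  interpret U: prob_space ?U
    using t_nonempty by (intro prob_space_uniform_count_measure) auto
  interpret pair: pair_prob_space ?U "\<mu> t" ..
  have S: "S L t l \<in> borel_measurable borel"
    unfolding S_def[abs_def] by measurable
  define F where "F = {\<sigma> \<in> space (\<mu> t). Pi_proj L t \<sigma> \<in> A}"
  define G where "G = {\<sigma> \<in> space (\<mu> t). Pi_proj L t \<sigma> \<in> S L t l -` A}"
  have Fs: "F \<in> sets (\<mu> t)"
    unfolding F_def by (rule measurable_sets_Collect[OF measurable_Pi_proj]) (use A in auto)
  have pre: "S L t l -` A \<in> sets borel" using measurable_sets[OF S A] by simp
  then have Gs: "G \<in> sets (\<mu> t)"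
    unfolding G_def
    by (intro measurable_sets_Collect[OF measurable_Pi_proj]) (simp add: vimage_def)
  let ?c = "\<lambda>(s, \<omega>). case_nat s \<omega> :: nat \<Rightarrow> nat"
  have c: "?c \<in> measurable (?U \<Otimes>\<^sub>M \<mu> t) (\<mu> t)"
  proof -
    have "(\<lambda>z i. case_nat (fst z) (snd z) i) \<in> measurable (?U \<Otimes>\<^sub>M \<mu> t) (\<mu> t)"
      unfolding \<mu>_def
    proof (rule measurable_PiM_single')
      fix i :: nat
      show "(\<lambda>z. case_nat (fst z) (snd z) i) \<in> measurable (?U \<Otimes>\<^sub>M (\<Pi>\<^sub>M n\<in>UNIV. ?U)) ?U"
        by (cases i) simp_all
    qed (auto simp: space_pair_measure space_PiM PiE_iff split: nat.splits)
    then show ?thesis by (simp add: case_prod_beta')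
  qed
  have iter: "distr (?U \<Otimes>\<^sub>M \<mu> t) (\<mu> t) ?c = \<mu> t"
    using sequence_space.PiM_iter[OF sequence_space_letters] unfolding \<mu>_def .
  have "measure ?U {l} * measure (\<mu> t) G = measure (?U \<Otimes>\<^sub>M \<mu> t) ({l} \<times> G)"
    using \<mu>.emeasure_pair_measure_Times[of "{l}" ?U G] l Gs
    by (simp add: measure_def enn2real_mult sets_uniform_count_measure)
  also have "\<dots> \<le> measure (?U \<Otimes>\<^sub>M \<mu> t) (?c -` F \<inter> space (?U \<Otimes>\<^sub>M \<mu> t))"
  proof (rule pair.finite_measure_mono)
    show "{l} \<times> G \<subseteq> ?c -` F \<inter> space (?U \<Otimes>\<^sub>M \<mu> t)"
      using l Pi_proj_Cons
      by (auto simp: G_def F_def space_pair_measure space_uniform_count_measure space_\<mu> Pi_iff split: nat.splits)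
    show "?c -` F \<inter> space (?U \<Otimes>\<^sub>M \<mu> t) \<in> sets (?U \<Otimes>\<^sub>M \<mu> t)"
      using measurable_sets[OF c Fs] .
  qed
  also have "\<dots> = measure (\<mu> t) F"
    using measure_distr[OF c Fs] unfolding iter by simp
  finally have "measure ?U {l} * measure (\<mu> t) G \<le> measure (\<mu> t) F" .
  moreover have "measure ?U {l} = 1 / real (length t)"
    using l by (subst measure_uniform_count_measure) auto
  ultimately show ?thesis
    unfolding measure_\<eta>[OF A] measure_\<eta>[OF pre] F_def[symmetric] G_def[symmetric]
    using t_nonempty by (simp add: pos_divide_le_eq[of "real (length t)"] mult.commute)
qed

text \<open>
  This is the only way in which positivity of \<open>\<eta> L t\<close> is propagated. It is applied to a basic
  interval \<open>A\<close>, and to an interval \<open>A\<close> that carries all of the measure.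
\<close>

lemma \<eta>_pos_of_S_word_image:
  assumes "set w \<subseteq> {..<length t}" "0 < measure (\<eta> L t) A"
    and "B \<in> sets borel" "A \<in> sets borel" "S_word L t w ` A \<subseteq> B"
  shows "0 < measure (\<eta> L t) B"
  using assms
proof (induction w arbitrary: B)
  case Nil
  interpret prob_space "\<eta> L t" by (rule prob_space_\<eta>)
  have "A \<subseteq> B" using Nil by force
  then show ?case
    using finite_measure_mono[of A B] Nil by (simp add: \<eta>_def)
next
  case (Cons l w)
  have S: "S L t l \<in> borel_measurable borel"
    unfolding S_def[abs_def] by measurable
  have pre: "S L t l -` B \<in> sets borel" using measurable_sets[OF S Cons.prems(3)] by simp
  have "0 < measure (\<eta> L t) (S L t l -` B)"
    by (rule Cons.IH) (use Cons.prems pre in auto)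
  then have "0 < real (length t) * measure (\<eta> L t) B"
    using \<eta>_preimage_le[of l B] Cons.prems by auto
  then show ?case by (simp add: zero_less_mult_iff)
qed

lemma finite_basic_indices: "finite (basic_indices L t)"
proof -
  have "b \<in> {-1..\<lceil>Pi_bound L t\<rceil>}" if b: "b \<in> basic_indices L t" for b
  proof -
    let ?I = "{of_int b * real L..(of_int b + 1) * real L}"
    have "0 < measure (\<mu> t) {\<sigma> \<in> space (\<mu> t). Pi_proj L t \<sigma> \<in> ?I}"
      using b by (simp add: basic_indices_def measure_\<eta>)
    then have "{\<sigma> \<in> space (\<mu> t). Pi_proj L t \<sigma> \<in> ?I} \<noteq> {}"
      by (metis less_irrefl measure_empty)
    then obtain \<sigma> where \<sigma>: "\<sigma> \<in> space (\<mu> t)" "Pi_proj L t \<sigma> \<in> ?I" by blast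
    have R: "0 \<le> Pi_proj L t \<sigma>" "Pi_proj L t \<sigma> \<le> Pi_bound L t"
      using Pi_proj_series(2)[of \<sigma>] \<sigma> by (auto simp: space_\<mu>)
    have "0 \<le> (of_int b + 1) * real L" using \<sigma> R by simp
    then have "-1 \<le> b" using L_pos by (simp add: zero_le_mult_iff)
    moreover have "b \<le> \<lceil>Pi_bound L t\<rceil>"
    proof (cases "b \<le> 0")
      case False
      then have "of_int b \<le> of_int b * real L" using L_ge_2 by simp
      also have "\<dots> \<le> Pi_bound L t" using \<sigma> R by simp
      finally show ?thesis by linarith
    next
      case True
      have "0 \<le> Pi_bound L t" using R by linarith
      then show ?thesis using True by linarith
    qed
    ultimately show ?thesis by simp
  qed
  then show ?thesis by (meson finite_atLeastAtMost_int finite_subset subsetI)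
qed

lemma basic_index_bij: "bij_betw (basic_index L t) {..<num_basic L t} (basic_indices L t)"
  unfolding num_basic_def basic_index_def[abs_def]
  using bij_betw_nth[of "sorted_list_of_set (basic_indices L t)"] finite_basic_indices
  by (simp add: atLeast0LessThan)

text \<open>
  The equation says that \<open>S_word L t w\<close> maps the basic interval with index \<open>b\<close> onto the
  subinterval, addressed by the digits \<open>ds\<close>, of the interval with index \<open>h\<close>. The latter
  therefore inherits positive measure. Thanks to this closure property, sums over
  intermediate intervals may be restricted to the basic ones, which index the matrices.
\<close>

lemma basic_indices_parent:
  assumes w: "set w \<subseteq> {..<length t}" and ds: "set ds \<subseteq> {..<L}" "length ds = length w"
    and b: "b \<in> basic_indices L t"
    and eq: "int (offset L t w) + b = h * int L ^ length w + int (radix_value L ds)"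
  shows "h \<in> basic_indices L t"
  unfolding basic_indices_def mem_Collect_eq
proof (rule \<eta>_pos_of_S_word_image[OF w])
  let ?I = "\<lambda>b. {of_int b * real L .. (of_int b + 1) * real L}"
  show "0 < measure (\<eta> L t) (?I b)" using b by (simp add: basic_indices_def)
  show "S_word L t w ` ?I b \<subseteq> ?I h"
  proof safe
    fix x assume x: "x \<in> ?I b"
    let ?n = "real L ^ length w"
    have n: "0 < ?n" using L_pos by simp
    have "radix_value L ds + 1 \<le> L ^ length w"
      using radix_value_less[OF L_pos ds(1)] ds(2) by simp
    then have v: "real (radix_value L ds) + 1 \<le> ?n"
      using of_nat_mono[of "radix_value L ds + 1" "L ^ length w", where 'a = real] by simp
    have "real_of_int (int (offset L t w) + b) = real_of_int (h * int L ^ length w + int (radix_value L ds))"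
      by (simp only: eq)
    then have e: "real (offset L t w) = of_int h * ?n + real (radix_value L ds) - of_int b"
      by simp
    have "of_int h * real L * ?n \<le> x + real L * real (offset L t w)"
    proof -
      have "0 \<le> real L * real (radix_value L ds)" by simp
      then show ?thesis using x unfolding e by (auto simp: algebra_simps intro: add_increasing2)
    qed
    moreover have "x + real L * real (offset L t w) \<le> (of_int h + 1) * real L * ?n"
    proof -
      have "real L * (real (radix_value L ds) + 1) \<le> real L * ?n"
        using v by (intro mult_left_mono) auto
      then show ?thesis using x unfolding e by (simp add: algebra_simps)
    qed
    ultimately show "S_word L t w x \<in> ?I h"
      unfolding S_word_eq_offset[OF L_pos] using n by (simp add: field_simps)
  qed
qed auto

text \<open>
  The measure charges every neighbourhood of a point of the attractor: a long enough initial
  segment of the code maps the whole attractor into the interval around that point.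
\<close>

lemma basic_indices_interior:
  assumes \<sigma>: "\<sigma> \<in> UNIV \<rightarrow> {..<length t}"
    and y: "of_int b * real L < Pi_proj L t \<sigma>" "Pi_proj L t \<sigma> < (of_int b + 1) * real L"
  shows "b \<in> basic_indices L t"
proof -
  let ?I = "{of_int b * real L .. (of_int b + 1) * real L}"
  let ?A = "{0..Pi_bound L t}"
  define d where "d = min (Pi_proj L t \<sigma> - of_int b * real L) ((of_int b + 1) * real L - Pi_proj L t \<sigma>)"
  have d: "0 < d" using y by (simp add: d_def)
  have "(\<lambda>n. Pi_bound L t * (1 / real L) ^ n) \<longlonglongrightarrow> Pi_bound L t * 0"
    using L_ge_2 by (intro tendsto_intros LIMSEQ_realpow_zero) auto
  then have "\<forall>\<^sub>F n in sequentially. Pi_bound L t * (1 / real L) ^ n < d"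
    using d by (intro order_tendstoD) auto
  then obtain n where n: "Pi_bound L t * (1 / real L) ^ n < d"
    using eventually_happens'[OF sequentially_bot] by blast
  define w where "w = initial n \<sigma>"
  have w: "set w \<subseteq> {..<length t}" unfolding w_def using set_initial[OF \<sigma>] .
  have shift: "(\<lambda>i. \<sigma> (n + i)) \<in> UNIV \<rightarrow> {..<length t}" using \<sigma> by auto
  have "0 < measure (\<eta> L t) ?I"
  proof (rule \<eta>_pos_of_S_word_image[OF w])
    interpret \<mu>: prob_space "\<mu> t" by (rule prob_space_\<mu>)
    have "{\<sigma> \<in> space (\<mu> t). Pi_proj L t \<sigma> \<in> ?A} = space (\<mu> t)"
      using Pi_proj_series(2) by (auto simp: space_\<mu>)
    then show "0 < measure (\<eta> L t) ?A"
      by (simp add: measure_\<eta> \<mu>.prob_space)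
    show "S_word L t w ` ?A \<subseteq> ?I"
    proof safe
      fix x assume x: "x \<in> ?A"
      have z: "Pi_proj L t (\<lambda>i. \<sigma> (n + i)) \<in> ?A" by (rule Pi_proj_series(2)[OF shift])
      have "Pi_proj L t \<sigma> = S_word L t w (Pi_proj L t (\<lambda>i. \<sigma> (n + i)))"
        unfolding w_def by (rule Pi_proj_self_similar[OF \<sigma>])
      then have "S_word L t w x - Pi_proj L t \<sigma> = (x - Pi_proj L t (\<lambda>i. \<sigma> (n + i))) / real L ^ n"
        by (simp add: S_word_eq_offset[OF L_pos] w_def diff_divide_distrib add_divide_distrib)
      then have "\<bar>S_word L t w x - Pi_proj L t \<sigma>\<bar> = \<bar>x - Pi_proj L t (\<lambda>i. \<sigma> (n + i))\<bar> / real L ^ n"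
        by (simp add: abs_divide)
      also have "\<dots> \<le> Pi_bound L t / real L ^ n"
        using x z by (intro divide_right_mono) auto
      also have "\<dots> < d" using n by (simp add: power_divide)
      finally show "S_word L t w x \<in> ?I" by (auto simp: d_def)
    qed
  qed auto
  then show ?thesis by (simp add: basic_indices_def)
qed

end


section \<open>Survival of words under coin tossing\<close>

definition alive :: "(nat list \<Rightarrow> 'a \<Rightarrow> bool) \<Rightarrow> nat list \<Rightarrow> 'a \<Rightarrow> bool" where
  "alive X w \<omega> \<longleftrightarrow> (\<forall>k\<in>{1..length w}. X (take k w) \<omega>)"

lemma alive_event:
  assumes X: "coin_tosses P M p X" and w: "set w \<subseteq> {..<M}"
  shows "{\<omega> \<in> space P. alive X w \<omega>} \<in> sets P"
    and "measure P {\<omega> \<in> space P. alive X w \<omega>} = p ^ length w"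
proof -
  interpret prob_space P using X by (simp add: coin_tosses_def)
  have indep: "indep_vars (\<lambda>_. count_space UNIV) X (finite_words M)"
    and p: "\<And>w. w \<in> finite_words M \<Longrightarrow> prob {\<omega> \<in> space P. X w \<omega>} = p"
    using X by (auto simp: coin_tosses_def)
  have prefix: "take k w \<in> finite_words M" if "k \<in> {1..length w}" for k
    using that w set_take_subset[of k w] by (auto simp: finite_words_def)
  have rv: "X u \<in> measurable P (count_space UNIV)" if "u \<in> finite_words M" for u
    using indep that by (simp add: indep_vars_def)
  have meas: "X u -` {True} \<inter> space P \<in> sets P" if "u \<in> finite_words M" for u
    using measurable_sets[OF rv[OF that]] by simp
  show "{\<omega> \<in> space P. alive X w \<omega>} \<in> sets P"
  proof -
    have "{\<omega> \<in> space P. X (take k w) \<omega>} \<in> sets P" if "k \<in> {1..length w}" for k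
      using meas[OF prefix[OF that]] by (simp add: vimage_def Int_def conj_commute)
    then show ?thesis unfolding alive_def by (intro sets.sets_Collect_finite_All) auto
  qed
  show "prob {\<omega> \<in> space P. alive X w \<omega>} = p ^ length w"
  proof (cases "w = []")
    case True
    then show ?thesis by (simp add: alive_def prob_space)
  next
    case False
    let ?J = "(\<lambda>k. take k w) ` {1..length w}"
    have inj: "inj_on (\<lambda>k. take k w) {1..length w}"
      by (rule inj_on_inverseI[where g = length]) auto
    have J: "?J \<noteq> {}" "finite ?J" "?J \<subseteq> finite_words M"
      using False prefix by (auto simp: Suc_le_eq)
    have "{\<omega> \<in> space P. alive X w \<omega>} = (\<Inter>u\<in>?J. X u -` {True} \<inter> space P)"
      using J(1) by (auto simp: alive_def)
    also have "prob \<dots> = (\<Prod>u\<in>?J. prob (X u -` {True} \<inter> space P))"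
      by (rule indep_varsD[OF indep J]) simp
    also have "\<dots> = (\<Prod>u\<in>?J. p)"
    proof (rule prod.cong[OF refl])
      fix u assume "u \<in> ?J"
      then have "prob {\<omega> \<in> space P. X u \<omega>} = p" using J(3) p by blast
      then show "prob (X u -` {True} \<inter> space P) = p"
        by (simp add: vimage_def Int_def conj_commute)
    qed
    also have "\<dots> = p ^ length w" using card_image[OF inj] by simp
    finally show ?thesis .
  qed
qed

section \<open>Counting words by matrix products\<close>

definition words :: "nat \<Rightarrow> nat \<Rightarrow> nat list set" where
  "words M n = {w. length w = n \<and> set w \<subseteq> {..<M}}"

lemma finite_words [simp]: "finite (words M n)"
  and card_words: "card (words M n) = M ^ n"
  using finite_lists_length_eq[of "{..<M}" n] card_lists_length_eq[of "{..<M}" n]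
  by (auto simp: words_def conj_commute)

text \<open>
  By the formula for \<open>S_word\<close>, these are the words of length \<open>m\<close> that map some basic interval
  onto the interval from \<open>j * L / L ^ m\<close> to \<open>(j + 1) * L / L ^ m\<close>, paired with the index
  of that basic interval.
\<close>

definition covering_words :: "nat \<Rightarrow> nat list \<Rightarrow> nat \<Rightarrow> int \<Rightarrow> (nat list \<times> int) set" where
  "covering_words L t m j =
     {(w, b) \<in> words (length t) m \<times> basic_indices L t. int (offset L t w) + b = j}"

context
  fixes L :: nat and t :: "nat list"
  assumes issifs: "issifs L t"
begin

lemma finite_covering_words [simp]: "finite (covering_words L t m j)"
  using finite_basic_indices[OF issifs]
  by (auto simp: covering_words_def intro: finite_subset[of _ "words (length t) m \<times> basic_indices L t"])

lemma L_gt_1: "1 < L"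
  using L_ge_2[OF issifs] by simp

lemma B_mat_carrier: "B_mat L t \<theta> \<in> carrier_mat (num_basic L t) (num_basic L t)"
  by (simp add: B_mat_def)

text \<open>
  The interval condition in the definition of the matrices, read as an equation in the integers.
\<close>

lemma B_mat_entry:
  assumes "i < num_basic L t" "k < num_basic L t"
  shows "B_mat L t \<theta> $$ (i, k) =
    real (card {l \<in> {..<length t}. int (t ! l) + basic_index L t k = basic_index L t i * int L + int \<theta>})"
proof -
  have "S L t l ` J L t k = J_sub L t i \<theta> \<longleftrightarrow>
      int (t ! l) + basic_index L t k = basic_index L t i * int L + int \<theta>" for l
  proof -
    let ?b = "real_of_int (basic_index L t k)" and ?h = "real_of_int (basic_index L t i)"
    have "S L t l = (\<lambda>x. (1 / real L) * x + real (t ! l))" by (auto simp: S_def)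
    then have "S L t l ` J L t k = {?b + real (t ! l) .. ?b + 1 + real (t ! l)}"
      unfolding J_def using L_gt_1
      by (simp only: image_affinity_atLeastAtMost) (auto simp: field_simps)
    then have "S L t l ` J L t k = J_sub L t i \<theta> \<longleftrightarrow> ?b + real (t ! l) = ?h * real L + real \<theta>"
      unfolding J_sub_def by (auto simp: Icc_eq_Icc)
    also have "\<dots> \<longleftrightarrow> real_of_int (int (t ! l) + basic_index L t k) =
        real_of_int (basic_index L t i * int L + int \<theta>)"
      by (auto simp: algebra_simps)
    finally show ?thesis by (simp only: of_int_eq_iff)
  qed
  then show ?thesis using assms by (simp add: B_mat_def)
qed

text \<open>
  Splitting off the first letter \<open>l\<close> of a word determines an intermediate index, which is basic
  by \<open>basic_indices_parent\<close>; summing over it is the multiplication by one more matrix.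
\<close>

lemma card_words_le_matprod:
  assumes "set ds \<subseteq> {..<L}" "i < num_basic L t" "k < num_basic L t"
  shows "real (card {w \<in> words (length t) (length ds).
            int (offset L t w) + basic_index L t k =
              basic_index L t i * int L ^ length ds + int (radix_value L ds)})
         \<le> foldr (*) (map (B_mat L t) ds) (1\<^sub>m (num_basic L t)) $$ (i, k)"
  using assms
proof (induction ds arbitrary: i)
  case Nil
  have "basic_index L t k = basic_index L t i \<Longrightarrow> i = k"
    using basic_index_bij[OF issifs] Nil by (auto simp: bij_betw_def inj_on_def)
  then show ?case using Nil by (auto simp: words_def card_le_Suc0_iff_eq)
next
  case (Cons d ds)
  let ?N = "num_basic L t" and ?b = "basic_index L t" and ?M = "length t"
  let ?A = "\<lambda>h. {l \<in> {..<?M}. int (t ! l) + ?b h = ?b i * int L + int d}"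
  let ?W = "\<lambda>h. {w \<in> words ?M (length ds). int (offset L t w) + ?b k =
      ?b h * int L ^ length ds + int (radix_value L ds)}"
  let ?P = "foldr (*) (map (B_mat L t) ds) (1\<^sub>m ?N)"
  have P: "?P \<in> carrier_mat ?N ?N"
    by (rule matprod_carrier) (auto simp: B_mat_carrier)
  let ?V = "{w \<in> words ?M (length (d # ds)). int (offset L t w) + ?b k =
      ?b i * int L ^ length (d # ds) + int (radix_value L (d # ds))}"
  have bk: "?b k \<in> basic_indices L t"
    using basic_index_bij[OF issifs] Cons.prems by (auto simp: bij_betw_def)
  have "?V \<subseteq> (\<Union>h<?N. (\<lambda>(l, w). l # w) ` (?A h \<times> ?W h))"
  proof
    fix v assume v: "v \<in> ?V"
    then obtain l w where lw: "v = l # w" "l < ?M" "w \<in> words ?M (length ds)"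
      by (cases v) (auto simp: words_def)
    define h where "h = ?b i * int L + int d - int (t ! l)"
    have w: "int (offset L t w) + ?b k = h * int L ^ length ds + int (radix_value L ds)"
      using v lw by (auto simp: h_def words_def algebra_simps)
    have "h \<in> basic_indices L t"
      by (rule basic_indices_parent[OF issifs _ _ _ bk, of w ds])
        (use w lw Cons.prems in \<open>auto simp: words_def\<close>)
    then obtain h' where h': "h' < ?N" "h = ?b h'"
      using basic_index_bij[OF issifs] by (auto simp: bij_betw_def)
    have "l \<in> ?A h'" using lw h' by (simp add: h_def)
    moreover have "w \<in> ?W h'" using lw w h' by simp
    ultimately show "v \<in> (\<Union>h<?N. (\<lambda>(l, w). l # w) ` (?A h \<times> ?W h))"
      using lw h' by force
  qed
  then have "card ?V \<le> card (\<Union>h<?N. (\<lambda>(l, w). l # w) ` (?A h \<times> ?W h))"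
    by (intro card_mono) auto
  also have "\<dots> \<le> (\<Sum>h<?N. card ((\<lambda>(l, w). l # w) ` (?A h \<times> ?W h)))"
    by (rule card_UN_le) simp
  also have "\<dots> \<le> (\<Sum>h<?N. card (?A h) * card (?W h))"
    by (intro sum_mono order_trans[OF card_image_le]) (auto simp: card_cartesian_product)
  finally have "real (card ?V) \<le> real (\<Sum>h<?N. card (?A h) * card (?W h))"
    by (simp only: of_nat_le_iff)
  also have "\<dots> = (\<Sum>h<?N. real (card (?A h)) * real (card (?W h)))"
    by simp
  also have "\<dots> \<le> (\<Sum>h<?N. B_mat L t d $$ (i, h) * ?P $$ (h, k))"
    using Cons by (intro sum_mono mult_mono) (auto simp: B_mat_entry)
  also have "\<dots> = (B_mat L t d * ?P) $$ (i, k)"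
    using Cons.prems by (intro mult_mat_entry[OF B_mat_carrier P, symmetric]) auto
  finally show ?case by simp
qed

text \<open>
  The first \<open>m\<close> letters of a word are counted crudely, with all \<open>length t ^ m\<close> possibilities. This costs
  a constant factor while \<open>m\<close> is fixed; the decay comes from the appended digits.
\<close>

lemma card_covering_words_append:
  assumes ds: "set ds \<subseteq> {..<L}"
  defines "N \<equiv> num_basic L t"
  shows "real (card (covering_words L t (m + length ds) (j * int L ^ length ds + int (radix_value L ds))))
     \<le> real (length t ^ m) * (\<Sum>i<N. \<Sum>k<N. foldr (*) (map (B_mat L t) ds) (1\<^sub>m N) $$ (i, k))"
proof -
  let ?b = "basic_index L t" and ?M = "length t"
  let ?W = "\<lambda>i k. {w \<in> words ?M (length ds). int (offset L t w) + ?b k =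
      ?b i * int L ^ length ds + int (radix_value L ds)}"
  let ?C = "covering_words L t (m + length ds) (j * int L ^ length ds + int (radix_value L ds))"
  let ?g = "\<lambda>k (u, w). (u @ w, ?b k)"
  have "?C \<subseteq> (\<Union>i<N. \<Union>k<N. ?g k ` (words ?M m \<times> ?W i k))"
  proof
    fix z assume z: "z \<in> ?C"
    obtain v b where vb: "z = (v, b)" by fastforce
    have v: "v \<in> words ?M (m + length ds)" and b: "b \<in> basic_indices L t"
      and eq: "int (offset L t v) + b = j * int L ^ length ds + int (radix_value L ds)"
      using z vb by (auto simp: covering_words_def)
    define u w where "u = take m v" and "w = drop m v"
    have uw: "v = u @ w" "u \<in> words ?M m" "w \<in> words ?M (length ds)"
      using v set_take_subset[of m v] set_drop_subset[of m v] by (auto simp: words_def u_def w_def)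
    define h where "h = j - int (offset L t u)"
    have w: "int (offset L t w) + b = h * int L ^ length ds + int (radix_value L ds)"
      using eq uw by (auto simp: h_def offset_append words_def algebra_simps)
    have "h \<in> basic_indices L t"
      by (rule basic_indices_parent[OF issifs _ ds _ b, of w])
        (use w uw in \<open>auto simp: words_def\<close>)
    then obtain i where i: "i < N" "h = ?b i"
      using basic_index_bij[OF issifs] by (auto simp: bij_betw_def N_def)
    obtain k where k: "k < N" "b = ?b k"
      using b basic_index_bij[OF issifs] by (auto simp: bij_betw_def N_def)
    have "w \<in> ?W i k" using uw w i k by simp
    then show "z \<in> (\<Union>i<N. \<Union>k<N. ?g k ` (words ?M m \<times> ?W i k))"
      using vb uw i k by force
  qed
  then have "card ?C \<le> card (\<Union>i<N. \<Union>k<N. ?g k ` (words ?M m \<times> ?W i k))"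
    by (intro card_mono) auto
  also have "\<dots> \<le> (\<Sum>i<N. card (\<Union>k<N. ?g k ` (words ?M m \<times> ?W i k)))"
    by (rule card_UN_le) simp
  also have "\<dots> \<le> (\<Sum>i<N. \<Sum>k<N. card (?g k ` (words ?M m \<times> ?W i k)))"
    by (intro sum_mono card_UN_le) simp
  also have "\<dots> \<le> (\<Sum>i<N. \<Sum>k<N. ?M ^ m * card (?W i k))"
    by (intro sum_mono order_trans[OF card_image_le]) (auto simp: card_cartesian_product card_words)
  finally have "real (card ?C) \<le> real (\<Sum>i<N. \<Sum>k<N. ?M ^ m * card (?W i k))"
    by (simp only: of_nat_le_iff)
  also have "\<dots> = (\<Sum>i<N. \<Sum>k<N. real (?M ^ m) * real (card (?W i k)))"
    by simp
  also have "\<dots> \<le> (\<Sum>i<N. \<Sum>k<N. real (?M ^ m) *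
      foldr (*) (map (B_mat L t) ds) (1\<^sub>m N) $$ (i, k))"
    unfolding N_def by (intro sum_mono mult_left_mono card_words_le_matprod ds) auto
  finally show ?thesis by (simp add: sum_distrib_left)
qed

section \<open>Cells of the L-adic partition and the first moment bound\<close>

text \<open>
  Normalized so that the cells of level 0 have length \<open>L\<close> and include the basic intervals.
\<close>

definition cell :: "nat \<Rightarrow> int \<Rightarrow> real set" where
  "cell m j = {of_int j * real L / real L ^ m .. (of_int j + 1) * real L / real L ^ m}"

lemma cell_subset_cell:
  assumes "set ds \<subseteq> {..<L}"
  shows "cell (m + length ds) (j * int L ^ length ds + int (radix_value L ds)) \<subseteq> cell m j"
proof -
  let ?n = "real L ^ length ds" and ?v = "real (radix_value L ds)"
  have L: "0 < real L" using L_gt_1 by simp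
  have "radix_value L ds + 1 \<le> L ^ length ds"
    using radix_value_less[OF _ assms] L_gt_1 by simp
  then have v: "?v + 1 \<le> ?n"
    using of_nat_mono[of "radix_value L ds + 1" "L ^ length ds", where 'a = real] by simp
  have "of_int j * real L / real L ^ m \<le> (of_int j * ?n + ?v) * real L / real L ^ (m + length ds)"
    using L by (simp add: power_add field_simps)
  moreover have "(of_int j * ?n + ?v + 1) * real L / real L ^ (m + length ds)
      \<le> (of_int j + 1) * real L / real L ^ m"
  proof -
    have "(of_int j * ?n + ?v + 1) * real L / real L ^ (m + length ds)
        \<le> (of_int j * ?n + ?n) * real L / real L ^ (m + length ds)"
      using v by (intro divide_right_mono mult_right_mono) auto
    also have "\<dots> = (of_int j + 1) * real L / real L ^ m"
      using L by (simp add: power_add field_simps)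
    finally show ?thesis .
  qed
  ultimately show ?thesis by (simp add: cell_def)
qed

lemma interval_contains_cell:
  assumes "is_interval I" "x \<in> I" "y \<in> I" "x \<noteq> y"
  obtains m j where "cell m j \<subseteq> I"
proof -
  define a b where "a = min x y" and "b = max x y"
  have ab: "a \<in> I" "b \<in> I" "a < b" using assms by (auto simp: a_def b_def min_def max_def)
  have L: "0 < real L" using L_gt_1 by simp
  have "(\<lambda>m. 2 * real L * (1 / real L) ^ m) \<longlonglongrightarrow> 2 * real L * 0"
    using L_gt_1 by (intro tendsto_intros LIMSEQ_realpow_zero) auto
  then have "\<forall>\<^sub>F m in sequentially. 2 * real L * (1 / real L) ^ m < b - a"
    using ab by (intro order_tendstoD) auto
  \<comment> \<open>The first grid point at or right of \<open>a\<close> is less than one cell length away, so two cell lengths suffice.\<close>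
  then obtain m where "2 * real L * (1 / real L) ^ m < b - a"
    using eventually_happens'[OF sequentially_bot] by blast
  then have m: "2 * (real L / real L ^ m) < b - a" by (simp add: power_divide)
  define s where "s = real L / real L ^ m"
  have s: "0 < s" using L by (simp add: s_def)
  define j where "j = \<lceil>a / s\<rceil>"
  have "a / s \<le> of_int j" "of_int j < a / s + 1" unfolding j_def by linarith+
  then have j: "a \<le> of_int j * s" "of_int j * s < a + s" using s by (simp_all add: field_simps)
  have "cell m j = {of_int j * s .. of_int j * s + s}"
    by (simp add: cell_def s_def distrib_right add_divide_distrib)
  also have "\<dots> \<subseteq> {a..b}" using j m by (auto simp: s_def)
  also have "\<dots> \<subseteq> I" using ab assms(1) by (meson atLeastAtMost_iff mem_is_interval_1_I subsetI)
  finally show ?thesis by (rule that)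
qed

text \<open>
  The midpoint of the cell has a surviving code. Its initial segment \<open>w\<close> of length \<open>m\<close> pulls the
  midpoint back to the midpoint of an interval from \<open>b * L\<close> to \<open>(b + 1) * L\<close> with integer \<open>b\<close>.
  As an interior point that lies on the attractor, it makes this interval basic.
\<close>

lemma alive_covering_word_of_cell_subset:
  assumes "cell m j \<subseteq> coin_tossing_set L t X \<omega>"
  shows "\<exists>(w, b) \<in> covering_words L t m j. alive X w \<omega>"
proof -
  have L: "0 < real L" using L_gt_1 by simp
  define x where "x = (of_int j + 1 / 2) * real L / real L ^ m"
  have "x \<in> cell m j"
    using L by (auto simp: cell_def x_def intro!: divide_right_mono mult_right_mono)
  then obtain \<sigma> where \<sigma>: "\<sigma> \<in> E_infinity (length t) X \<omega>" "x = Pi_proj L t \<sigma>"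
    using assms by (auto simp: coin_tossing_set_def)
  have \<sigma>M: "\<sigma> \<in> UNIV \<rightarrow> {..<length t}" using \<sigma> by (simp add: E_infinity_def)
  let ?w = "initial m \<sigma>" and ?\<tau> = "\<lambda>i. \<sigma> (m + i)"
  define b where "b = j - int (offset L t ?w)"
  have "x = (Pi_proj L t ?\<tau> + real L * real (offset L t ?w)) / real L ^ m"
    using \<sigma> Pi_proj_self_similar[OF issifs \<sigma>M, of m] L by (simp add: S_word_eq_offset)
  then have "Pi_proj L t ?\<tau> + real L * real (offset L t ?w) = (of_int j + 1 / 2) * real L"
    using L by (simp add: x_def)
  then have y: "Pi_proj L t ?\<tau> = (of_int b + 1 / 2) * real L"
    by (simp add: b_def algebra_simps)
  have "b \<in> basic_indices L t"
    by (rule basic_indices_interior[OF issifs, of ?\<tau>]) (use \<sigma>M y L in \<open>auto simp: Pi_iff\<close>)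
  then have "(?w, b) \<in> covering_words L t m j"
    using set_initial[OF \<sigma>M] by (auto simp: covering_words_def words_def b_def)
  moreover have "alive X ?w \<omega>"
    using \<sigma> by (auto simp: alive_def E_infinity_def take_initial)
  ultimately show ?thesis by blast
qed

lemma prob_alive_covering_word_le:
  fixes m :: nat and j :: int
  assumes X: "coin_tosses P (length t) p X"
  defines "D \<equiv> {\<omega> \<in> space P. \<exists>(w, b) \<in> covering_words L t m j. alive X w \<omega>}"
  shows "D \<in> sets P" and "measure P D \<le> p ^ m * real (card (covering_words L t m j))"
proof -
  interpret prob_space P using X by (simp add: coin_tosses_def)
  let ?E = "\<lambda>(w, b :: int). {\<omega> \<in> space P. alive X w \<omega>}"
  have D: "D = (\<Union>z\<in>covering_words L t m j. ?E z)" by (auto simp: D_def)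
  have E: "?E z \<in> sets P" "prob (?E z) = p ^ m" if "z \<in> covering_words L t m j" for z
    using alive_event[OF X] that by (auto simp: covering_words_def words_def)
  show "D \<in> sets P" unfolding D using E by (intro sets.finite_UN) auto
  have "prob D \<le> (\<Sum>z\<in>covering_words L t m j. prob (?E z))"
    unfolding D using E by (intro finite_measure_subadditive_finite) auto
  also have "\<dots> = p ^ m * real (card (covering_words L t m j))"
    using E by simp
  finally show "prob D \<le> p ^ m * real (card (covering_words L t m j))" .
qed

text \<open>
  Below the given cell lies the nested sequence of cells obtained by appending \<open>k\<close> times the
  digits of a contracting product. If the given cell is contained in the random set, then each
  of these smaller cells is covered by a surviving word. The expected number of such words
  decays geometrically in \<open>k\<close>, so the event lies in a null set.
\<close>

lemma AE_not_cell_subset: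
  assumes X: "coin_tosses P (length t) p X" and p: "0 < p"
    and nrm: "submult_matrix_norm (num_basic L t) nrm"
    and less: "ereal p < inverse (ereal (lower_spectral_radius (num_basic L t) nrm (B_set L t)))"
  shows "AE \<omega> in P. \<not> cell m j \<subseteq> coin_tossing_set L t X \<omega>"
proof -
  interpret prob_space P using X by (simp add: coin_tosses_def)
  let ?N = "num_basic L t"
  have B: "B_set L t \<subseteq> carrier_mat ?N ?N" "B_set L t \<noteq> {}"
    using L_gt_1 by (auto simp: B_set_def B_mat_carrier)
  obtain w where w: "w \<noteq> []" "set w \<subseteq> B_set L t" "p ^ length w * nrm (foldr (*) w (1\<^sub>m ?N)) < 1"
    using contracting_product_exists[OF nrm B p less] by blast
  then have "w \<in> lists (B_mat L t ` {..<L})" by (auto simp: B_set_def)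
  then obtain \<theta> where \<theta>: "w = map (B_mat L t) \<theta>" "set \<theta> \<subseteq> {..<L}"
    unfolding lists_image by auto
  define c where "c = p ^ length \<theta> * nrm (foldr (*) w (1\<^sub>m ?N))"
  have c: "0 \<le> c" "c < 1"
    using w \<theta> p norm_matprod_nonneg[OF nrm B(1) w(2)] by (auto simp: c_def)
  define ds where "ds k = concat (replicate k \<theta>)" for k
  have ds: "set (ds k) \<subseteq> {..<L}" for k using \<theta> by (auto simp: ds_def split: if_splits)
  have len: "length (ds k) = k * length \<theta>" for k
    by (simp add: ds_def length_concat sum_list_replicate)
  define Q where "Q k = foldr (*) (map (B_mat L t) (ds k)) (1\<^sub>m ?N)" for k
  have Q: "Q k \<in> carrier_mat ?N ?N" for k
    unfolding Q_def by (rule matprod_carrier) (auto simp: B_mat_carrier)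
  have Qn: "p ^ length (ds k) * nrm (Q k) \<le> nrm (1\<^sub>m ?N) * c ^ k" for k
  proof -
    have "Q k = foldr (*) (concat (replicate k w) @ []) (1\<^sub>m ?N)"
      by (simp add: Q_def ds_def \<theta> map_concat)
    then have "nrm (Q k) \<le> nrm (foldr (*) w (1\<^sub>m ?N)) ^ k * nrm (1\<^sub>m ?N)"
      using norm_matprod_repeat[OF nrm, of w "[]" k] w(2) B(1) by auto
    then have "p ^ length (ds k) * nrm (Q k)
        \<le> p ^ length (ds k) * (nrm (foldr (*) w (1\<^sub>m ?N)) ^ k * nrm (1\<^sub>m ?N))"
      using p by (intro mult_left_mono) auto
    also have "\<dots> = nrm (1\<^sub>m ?N) * c ^ k"
      by (simp add: len c_def power_mult_distrib power_mult mult.commute[of k])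
    finally show ?thesis .
  qed
  have entry: "(\<lambda>k. p ^ length (ds k) * Q k $$ (i, h)) \<longlonglongrightarrow> 0" if ih: "i < ?N" "h < ?N" for i h
  proof -
    obtain C where C: "\<And>A. A \<in> carrier_mat ?N ?N \<Longrightarrow> \<bar>A $$ (i, h)\<bar> \<le> C * nrm A"
      using entry_bounded_by_norm[OF nrm ih] by blast
    have bd: "norm (p ^ length (ds k) * Q k $$ (i, h)) \<le> \<bar>C\<bar> * (nrm (1\<^sub>m ?N) * c ^ k)" for k
    proof -
      have nn: "0 \<le> nrm (Q k)" using nrm Q by (auto simp: submult_matrix_norm_def)
      have "\<bar>Q k $$ (i, h)\<bar> \<le> \<bar>C\<bar> * nrm (Q k)"
        using C[OF Q, of k] mult_right_mono[OF abs_ge_self[of C] nn] by linarith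
      then have "p ^ length (ds k) * \<bar>Q k $$ (i, h)\<bar> \<le> p ^ length (ds k) * (\<bar>C\<bar> * nrm (Q k))"
        using p by (intro mult_left_mono) auto
      also have "\<dots> = \<bar>C\<bar> * (p ^ length (ds k) * nrm (Q k))" by simp
      also have "\<dots> \<le> \<bar>C\<bar> * (nrm (1\<^sub>m ?N) * c ^ k)"
        by (intro mult_left_mono Qn) auto
      finally show ?thesis using p by (simp add: abs_mult)
    qed
    have "(\<lambda>k. \<bar>C\<bar> * (nrm (1\<^sub>m ?N) * c ^ k)) \<longlonglongrightarrow> \<bar>C\<bar> * (nrm (1\<^sub>m ?N) * 0)"
      using c by (intro tendsto_intros LIMSEQ_realpow_zero) auto
    then have "(\<lambda>k. \<bar>C\<bar> * (nrm (1\<^sub>m ?N) * c ^ k)) \<longlonglongrightarrow> 0" by simp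
    from Lim_null_comparison[OF always_eventually[OF allI[OF bd]] this] show ?thesis .
  qed
  define jj where "jj k = j * int L ^ length (ds k) + int (radix_value L (ds k))" for k
  define D where "D k = {\<omega> \<in> space P. \<exists>(w, b) \<in> covering_words L t (m + length (ds k)) (jj k). alive X w \<omega>}" for k
  have Ds: "D k \<in> sets P" for k unfolding D_def by (rule prob_alive_covering_word_le(1)[OF X])
  let ?u = "\<lambda>k. p ^ m * real (length t ^ m) * (\<Sum>i<?N. \<Sum>h<?N. p ^ length (ds k) * Q k $$ (i, h))"
  have Dp: "prob (D k) \<le> ?u k" for k
  proof -
    have "prob (D k) \<le> p ^ (m + length (ds k)) * real (card (covering_words L t (m + length (ds k)) (jj k)))"
      unfolding D_def by (rule prob_alive_covering_word_le(2)[OF X])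
    also have "\<dots> \<le> p ^ (m + length (ds k)) * (real (length t ^ m) * (\<Sum>i<?N. \<Sum>h<?N. Q k $$ (i, h)))"
      unfolding Q_def jj_def using p by (intro mult_left_mono card_covering_words_append ds) auto
    also have "\<dots> = ?u k" by (simp add: power_add sum_distrib_left mult_ac)
    finally show ?thesis .
  qed
  have "?u \<longlonglongrightarrow> p ^ m * real (length t ^ m) * (\<Sum>i<?N. \<Sum>h<?N. 0)"
    by (intro tendsto_intros entry) auto
  then have u: "?u \<longlonglongrightarrow> 0" by simp
  have "prob (\<Inter>k. D k) \<le> ?u k" for k
    by (rule order_trans[OF finite_measure_mono Dp]) (use Ds in auto)
  then have "prob (\<Inter>k. D k) \<le> 0"
    using LIMSEQ_le_const[OF u] by blast
  then have null: "(\<Inter>k. D k) \<in> null_sets P"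
    using Ds by (intro null_setsI) (auto simp: emeasure_eq_measure measure_le_0_iff)
  show ?thesis
  proof (rule AE_I'[OF null], intro subsetI INT_I)
    fix \<omega> k assume "\<omega> \<in> {\<omega> \<in> space P. \<not> \<not> cell m j \<subseteq> coin_tossing_set L t X \<omega>}"
    then have \<omega>: "\<omega> \<in> space P" "cell m j \<subseteq> coin_tossing_set L t X \<omega>" by auto
    then have "cell (m + length (ds k)) (jj k) \<subseteq> coin_tossing_set L t X \<omega>"
      unfolding jj_def using cell_subset_cell[OF ds] by blast
    from alive_covering_word_of_cell_subset[OF this] \<omega>(1) show "\<omega> \<in> D k"
      unfolding D_def by simp
  qed
qed

end

theorem proposition6p2:
  fixes L :: nat and t :: "nat list" and p :: real
    and P :: "'a measure" and X :: "nat list \<Rightarrow> 'a \<Rightarrow> bool"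
    and nrm :: "real mat \<Rightarrow> real"
  assumes "issifs L t"
    and "0 < p" and "p \<le> 1"
    and "coin_tosses P (length t) p X"
    and "submult_matrix_norm (num_basic L t) nrm"
    and "ereal p < inverse (ereal (lower_spectral_radius (num_basic L t) nrm (B_set L t)))"
  shows "AE \<omega> in P. \<not> contains_interval (coin_tossing_set L t X \<omega>)"
proof -
  have "AE \<omega> in P. \<forall>m j. \<not> cell L m j \<subseteq> coin_tossing_set L t X \<omega>"
    using AE_not_cell_subset[OF assms(1,4,2,5,6)] by (simp add: AE_all_countable)
  then show ?thesis
  proof eventually_elim
    case (elim \<omega>)
    show ?case
      unfolding contains_interval_def
      using elim interval_contains_cell[OF assms(1)] by (meson subset_trans)
  qed
qed

end
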